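(* Let $k\geq 2$ be an integer. The complete signed distance graph of the signed projective cube $SPC(2k-1)$ satisfies the all $k$-good property.
   Context: A signed graph $(G,\Sigma)$ is a finite simple graph $G$ with a set $\Sigma\subseteq E(G)$ of negative edges; the other edges are positive. A closed walk, path or cycle is balanced if the product of the signs of its edges, counted with repetition, is $+$, and unbalanced otherwise. The unbalanced-girth is the length of a shortest unbalanced cycle ($\infty$ if there is none). Signed projective cube: for $d\ge 2$, $SPC(d)$ is the signed graph with vertex set $\mathbb{Z}_2^{d}$ where $u,v$ are adjacent if and only if $u-v\in\{e_1,\dots,e_d,J\}$, with $e_1,\dots,e_d$ the standard basis and $J$ the all-$1$ vector; an edge is negative if $u-v=J$ and positive otherwise. Algebraic distance: for vertices $u,v$ of a connected signed graph $(G,\Sigma)$, with $d_G$ the usual graph distance, $ad_{(G,\Sigma)}(u,v)=d_G(u,v)$ if there is a balanced $u$–$v$ path of length $d_G(u,v)$, and $ad_{(G,\Sigma)}(u,v)=-d_G(u,v)$ otherwise. The complete signed distance graph of a connected signed graph $(G,\Sigma)$ is the complete graph on vertex set $V(G)$ in which each edge $uv$ has weight $ad_{(G,\Sigma)}(u,v)$. $k$-good triples: let $p,q,r$ be non-zero integers of absolute value at most $k$ with $p+q+r$ even. $T_{2k}(p,q,r)$ is the signed bipartite graph built from three vertices $u,v,w$ by joining $u$ and $v$ by two internally disjoint paths of lengths $|p|$ and $2k-|p|$, joining $u$ and $w$ by two such paths of lengths $|q|$ and $2k-|q|$, and joining $v$ and $w$ by two such paths of lengths $|r|$ and $2k-|r|$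 (all six paths internally disjoint). For each of $p,q,r$ (call it $s$) and the corresponding pair of paths, exactly one edge is negative: it lies on the path of length $|s|$ if $s<0$, and on the path of length $2k-|s|$ if $s>0$. (The choice of edge on the path is irrelevant up to switching signs along edge-cuts.) The triple $(p,q,r)$ is $k$-good if $T_{2k}(p,q,r)$ has unbalanced-girth $2k$. All $k$-good property: let $(G,w)$ be a graph with edge weights $w:E(G)\to\mathbb{Z}\setminus\{0\}$, $|w(e)|\le k$ for all edges $e$, which is bipartite in the sense that there is a partition $\{X,Y\}$ of $V(G)$ such that edges between $X$ and $Y$ have odd weight and edges inside $X$ or inside $Y$ have even weight. $(G,w)$ has the all $k$-good property if for any edge $uv$ of $G$ with weight $p$ and any integers $q$ and $r$ such that $(p,q,r)$ is a $k$-good triple, there exists a vertex $z$ in $V(G)$ such that $uz$ and $vz$ are edges of $G$ with either $w(uz)=q$ and $w(vz)=r$, or $w(uz)=-q$ and $w(vz)=-r$.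
   Formalization: Weights k and −k are identified when w(uz), w(vz) are compared with ±q, ±r, so for |q|=k or |r|=k the signs are relaxed; literally the claim fails, since (2,k,−k) is k-good but −k is never an algebraic distance in SPC(2k−1). *)

theory Defs
  imports Main "HOL-Library.Extended_Nat" "HOL-Library.Z2" "HOL-Library.Function_Algebras"
begin

section \<open>Signed graphs\<close>

text \<open>Edges are two-element sets of vertices.\<close>

record 'a signed_graph =
  verts :: "'a set"
  edges :: "'a set set"
  negs :: "'a set set"

definition signed_graph :: "'a signed_graph \<Rightarrow> bool" where
  "signed_graph G \<longleftrightarrow>
     finite (verts G) \<and>
     edges G \<subseteq> {{u, v} |u v. u \<in> verts G \<and> v \<in> verts G \<and> u \<noteq> v} \<and>
     negs G \<subseteq> edges G"

text \<open>
  A walk is given by its nonempty list of successive vertices, so its length is one less than the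
  length of the list, and its edges are listed with repetition.
\<close>

definition walk_edges :: "'a list \<Rightarrow> 'a set list" where
  "walk_edges xs = map (\<lambda>(x, y). {x, y}) (zip xs (tl xs))"

definition walk :: "'a signed_graph \<Rightarrow> 'a list \<Rightarrow> bool" where
  "walk G xs \<longleftrightarrow> xs \<noteq> [] \<and> set xs \<subseteq> verts G \<and> set (walk_edges xs) \<subseteq> edges G"

definition walk_length :: "'a list \<Rightarrow> nat" where
  "walk_length xs = length (walk_edges xs)"

definition edge_sign :: "'a signed_graph \<Rightarrow> 'a set \<Rightarrow> int" where
  "edge_sign G e = (if e \<in> negs G then - 1 else 1)"

definition balanced :: "'a signed_graph \<Rightarrow> 'a list \<Rightarrow> bool" where
  "balanced G xs \<longleftrightarrow> prod_list (map (edge_sign G) (walk_edges xs)) = 1"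

definition path_between :: "'a signed_graph \<Rightarrow> 'a \<Rightarrow> 'a \<Rightarrow> 'a list \<Rightarrow> bool" where
  "path_between G u v xs \<longleftrightarrow> walk G xs \<and> distinct xs \<and> hd xs = u \<and> last xs = v"

text \<open>A cycle is listed with its starting vertex repeated at the end.\<close>

definition cycle :: "'a signed_graph \<Rightarrow> 'a list \<Rightarrow> bool" where
  "cycle G xs \<longleftrightarrow> walk G xs \<and> hd xs = last xs \<and> distinct (tl xs) \<and> 3 \<le> walk_length xs"

definition unbalanced_girth :: "'a signed_graph \<Rightarrow> enat" where
  "unbalanced_girth G = (INF xs \<in> {xs. cycle G xs \<and> \<not> balanced G xs}. enat (walk_length xs))"

definition connected_sg :: "'a signed_graph \<Rightarrow> bool" where
  "connected_sg G \<longleftrightarrow> (\<forall>u\<in>verts G. \<forall>v\<in>verts G. \<exists>xs. path_between G u v xs)"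

section \<open>Signed projective cubes\<close>

text \<open>
  The elements of \<open>\<int>\<^sub>2\<^sup>d\<close> are the functions from \<^typ>\<open>nat\<close> to \<^typ>\<open>bit\<close> (the field with two
  elements) that vanish outside \<open>{0..<d}\<close>; subtraction of functions is pointwise.
\<close>

definition bit_vectors :: "nat \<Rightarrow> (nat \<Rightarrow> bit) set" where
  "bit_vectors d = {u. \<forall>i\<ge>d. u i = 0}"

definition unit_vector :: "nat \<Rightarrow> nat \<Rightarrow> bit" where
  "unit_vector i = (\<lambda>j. if j = i then 1 else 0)"

definition all_ones :: "nat \<Rightarrow> nat \<Rightarrow> bit" where
  "all_ones d = (\<lambda>j. if j < d then 1 else 0)"

definition SPC :: "nat \<Rightarrow> (nat \<Rightarrow> bit) signed_graph" where
  "SPC d =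
     \<lparr>verts = bit_vectors d,
      edges = {{u, v} |u v. u \<in> bit_vectors d \<and> v \<in> bit_vectors d \<and>
                            u - v \<in> unit_vector ` {0..<d} \<union> {all_ones d}},
      negs = {{u, v} |u v. u \<in> bit_vectors d \<and> v \<in> bit_vectors d \<and> u - v = all_ones d}\<rparr>"

lemma signed_graph_SPC:
  assumes "d \<ge> 1"
  shows "signed_graph (SPC d)"
proof -
  have "finite (UNIV :: bit set)"
  proof (rule finite_subset)
    show "(UNIV :: bit set) \<subseteq> {0, 1}"
    proof
      fix b :: bit show "b \<in> {0, 1}" by (cases b) simp_all
    qed
  qed simp
  then have "finite {u :: nat \<Rightarrow> bit. \<forall>i. (i \<in> {..<d} \<longrightarrow> u i \<in> UNIV) \<and> (i \<notin> {..<d} \<longrightarrow> u i = 0)}"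
    by (rule finite_set_of_finite_funs[OF finite_lessThan])
  then have fin: "finite (bit_vectors d)"
    by (rule rev_finite_subset) (auto simp: bit_vectors_def)
  have "0 \<notin> unit_vector ` {0..<d} \<union> {all_ones d}"
  proof
    assume "0 \<in> unit_vector ` {0..<d} \<union> {all_ones d}"
    then consider i where "unit_vector i = 0" | "all_ones d = 0" by force
    then show False
    proof cases
      case 1
      from fun_cong[OF this, of i] show False by (simp add: unit_vector_def)
    next
      case 2
      from fun_cong[OF this, of 0] show False using assms by (simp add: all_ones_def)
    qed
  qed
  have "u \<noteq> v" if "u - v \<in> unit_vector ` {0..<d} \<union> {all_ones d}" for u v
  proof
    assume "u = v"
    then have "u - v = 0" by (simp add: fun_eq_iff)
    from that[unfolded this] \<open>0 \<notin> unit_vector ` {0..<d} \<union> {all_ones d}\<close> show False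
      by (rule notE[rotated])
  qed
  then have "edges (SPC d) \<subseteq> {{u, v} |u v. u \<in> verts (SPC d) \<and> v \<in> verts (SPC d) \<and> u \<noteq> v}"
    unfolding SPC_def signed_graph.simps by (intro Collect_mono impI) (elim ex_forward conj_forward)
  moreover have "negs (SPC d) \<subseteq> edges (SPC d)"
    unfolding SPC_def signed_graph.simps by (intro Collect_mono impI) (elim ex_forward conj_forward, simp_all)
  moreover have "finite (verts (SPC d))"
    using fin by (simp add: SPC_def)
  ultimately show ?thesis
    unfolding signed_graph_def by metis
qed

lemma connected_SPC: "connected_sg (SPC d)"
proof -
  have "\<exists>xs. path_between (SPC d) u v xs \<and> (\<forall>x\<in>set xs. \<forall>i. i \<notin> S \<longrightarrow> x i = v i)"
    if "finite S" "S = {i. u i \<noteq> v i}" "u \<in> bit_vectors d" "v \<in> bit_vectors d" for u v S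
    using that
  proof (induction S arbitrary: u rule: finite_induct)
    case empty
    then have "u = v" by auto
    then show ?case using empty
      by (intro exI[of _ "[v]"]) (auto simp: path_between_def walk_def walk_edges_def SPC_def)
  next
    case (insert i S)
    have ui: "u i \<noteq> v i" using insert.prems by auto
    then have id: "i < d" using insert.prems(2,3) by (cases "i < d") (auto simp: bit_vectors_def)
    define u' where "u' = u(i := v i)"
    have u': "u' \<in> bit_vectors d" using insert.prems id by (auto simp: u'_def bit_vectors_def)
    have "S = {j. u' j \<noteq> v j}" using insert.prems insert.hyps by (auto simp: u'_def)
    from insert.IH[OF this u' insert.prems(3)] obtain xs
      where xs: "path_between (SPC d) u' v xs" "\<forall>x\<in>set xs. \<forall>j. j \<notin> S \<longrightarrow> x j = v j"
      by auto
    have "u - u' = unit_vector i"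
    proof
      fix j
      show "(u - u') j = unit_vector i j"
        using ui by (cases "u i"; cases "v i") (auto simp: u'_def unit_vector_def)
    qed
    then have e: "{u, u'} \<in> edges (SPC d)"
    proof -
      have "u - u' \<in> unit_vector ` {0..<d} \<union> {all_ones d}"
        using \<open>u - u' = unit_vector i\<close> id by simp
      then show ?thesis
        using u' insert.prems(2) by (simp only: SPC_def signed_graph.simps) blast
    qed
    have nin: "u \<notin> set xs" using xs(2) insert.hyps ui by auto
    obtain ys where ys: "xs = u' # ys"
      using xs(1) by (cases xs) (auto simp: path_between_def walk_def)
    have "path_between (SPC d) u v (u # xs)"
    proof -
      have "u \<in> verts (SPC d)" using insert.prems(2) by (simp add: SPC_def)
      then show ?thesis
        using xs(1) e nin unfolding path_between_def walk_def walk_edges_def ys by simp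
    qed
    moreover have "\<forall>x\<in>set (u # xs). \<forall>j. j \<notin> insert i S \<longrightarrow> x j = v j"
      using xs(2) insert.prems(1) by auto
    ultimately show ?case by blast
  qed
  moreover have "finite {i. u i \<noteq> v i}" if "u \<in> bit_vectors d" "v \<in> bit_vectors d" for u v
  proof (rule finite_subset)
    show "{i. u i \<noteq> v i} \<subseteq> {..<d}"
    proof
      fix i assume "i \<in> {i. u i \<noteq> v i}"
      with that show "i \<in> {..<d}" by (cases "i < d") (auto simp: bit_vectors_def)
    qed
  qed simp
  moreover have "verts (SPC d) = bit_vectors d" by (simp only: SPC_def signed_graph.simps)
  ultimately show ?thesis
    unfolding connected_sg_def by metis
qed

section \<open>Algebraic distance\<close>

text \<open>\<open>graph_dist\<close> and \<open>alg_dist\<close> are meaningful for vertices of connected signed graphs only.\<close>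

definition graph_dist :: "'a signed_graph \<Rightarrow> 'a \<Rightarrow> 'a \<Rightarrow> nat" where
  "graph_dist G u v = (LEAST n. \<exists>xs. path_between G u v xs \<and> walk_length xs = n)"

definition alg_dist :: "'a signed_graph \<Rightarrow> 'a \<Rightarrow> 'a \<Rightarrow> int" where
  "alg_dist G u v =
     (if \<exists>xs. path_between G u v xs \<and> walk_length xs = graph_dist G u v \<and> balanced G xs
      then int (graph_dist G u v) else - int (graph_dist G u v))"

text \<open>
  The weight of an edge \<open>{u, v}\<close> of a weighted graph is \<open>weight G u v = weight G v u\<close>;
  values of \<open>weight G\<close> at pairs that are not edges are irrelevant.
\<close>

record 'a weighted_graph =
  wverts :: "'a set"
  wedges :: "'a set set"
  weight :: "'a \<Rightarrow> 'a \<Rightarrow> int"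

definition complete_signed_distance_graph :: "'a signed_graph \<Rightarrow> 'a weighted_graph" where
  "complete_signed_distance_graph G =
     \<lparr>wverts = verts G,
      wedges = {{u, v} |u v. u \<in> verts G \<and> v \<in> verts G \<and> u \<noteq> v},
      weight = alg_dist G\<rparr>"

section \<open>Good triples\<close>

datatype hub = HU | HV | HW
datatype side = UV | UW | VW

fun side_ends :: "side \<Rightarrow> hub \<times> hub" where
  "side_ends UV = (HU, HV)"
| "side_ends UW = (HU, HW)"
| "side_ends VW = (HV, HW)"

text \<open>
  Each side carries a path of length \<open>\<bar>s\<bar>\<close> (flag \<^term>\<open>True\<close>) and a path of length
  \<open>2k - \<bar>s\<bar>\<close> (flag \<^term>\<open>False\<close>).  \<^term>\<open>Inner e b i\<close> is the vertex at distance \<open>i\<close> from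
  the first end along the path with flag \<open>b\<close> on the side \<open>e\<close>.
\<close>

datatype tvertex = Hub hub | Inner side bool nat

definition path_vertex :: "side \<Rightarrow> bool \<Rightarrow> nat \<Rightarrow> nat \<Rightarrow> tvertex" where
  "path_vertex e b n i =
     (if i = 0 then Hub (fst (side_ends e))
      else if i = n then Hub (snd (side_ends e)) else Inner e b i)"

definition path_len :: "nat \<Rightarrow> int \<Rightarrow> bool \<Rightarrow> nat" where
  "path_len k s b = (if b then nat \<bar>s\<bar> else 2 * k - nat \<bar>s\<bar>)"

fun side_value :: "int \<Rightarrow> int \<Rightarrow> int \<Rightarrow> side \<Rightarrow> int" where
  "side_value p q r UV = p"
| "side_value p q r UW = q"
| "side_value p q r VW = r"

text \<open>
  The negative edge of a side is taken to be the first edge of the path that has to contain it.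
  The path with flag \<open>b\<close> has to contain it exactly if \<open>b \<longleftrightarrow> s < 0\<close>.
\<close>

definition T2k :: "nat \<Rightarrow> int \<Rightarrow> int \<Rightarrow> int \<Rightarrow> tvertex signed_graph" where
  "T2k k p q r =
     (let len = (\<lambda>e b. path_len k (side_value p q r e) b);
          vert = (\<lambda>e b. path_vertex e b (len e b))
      in \<lparr>verts = {vert e b i |e b i. i \<le> len e b},
          edges = {{vert e b i, vert e b (Suc i)} |e b i. i < len e b},
          negs = {{vert e b 0, vert e b 1} |e b. b \<longleftrightarrow> side_value p q r e < 0}\<rparr>)"

lemma signed_graph_T2k:
  assumes "k \<ge> 2" and "\<forall>s\<in>{p, q, r}. s \<noteq> 0 \<and> \<bar>s\<bar> \<le> int k"
  shows "signed_graph (T2k k p q r)"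
proof -
  define len where "len = (\<lambda>e b. path_len k (side_value p q r e) b)"
  define vert where "vert = (\<lambda>e b. path_vertex e b (len e b))"
  have side: "side_value p q r e \<in> {p, q, r}" for e by (cases e) auto
  have len: "len e b > 0" for e b
    using assms side[of e] unfolding len_def path_len_def by (cases b) auto
  have T: "T2k k p q r = \<lparr>verts = {vert e b i |e b i. i \<le> len e b},
      edges = {{vert e b i, vert e b (Suc i)} |e b i. i < len e b},
      negs = {{vert e b 0, vert e b 1} |e b. b \<longleftrightarrow> side_value p q r e < 0}\<rparr>"
    unfolding T2k_def len_def vert_def Let_def ..
  have ends: "fst (side_ends e) \<noteq> snd (side_ends e)" for e by (cases e) auto
  have ne: "vert e b i \<noteq> vert e b (Suc i)" if "i < len e b" for e b i
    using that ends[of e] by (auto simp: vert_def path_vertex_def)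
  have "UNIV = {UV, UW, VW}" using side.exhaust by auto
  then have fin_side: "finite (UNIV :: side set)" by (metis finite.emptyI finite_insert)
  have "{vert e b i |e b i. i \<le> len e b} = (\<Union>e. \<Union>b. vert e b ` {..len e b})" by auto
  then have "finite (verts (T2k k p q r))" using fin_side by (simp add: T)
  moreover have "edges (T2k k p q r) \<subseteq>
      {{u, v} |u v. u \<in> verts (T2k k p q r) \<and> v \<in> verts (T2k k p q r) \<and> u \<noteq> v}"
    unfolding T using ne by (fastforce intro: Suc_leI less_imp_le)
  moreover have "negs (T2k k p q r) \<subseteq> edges (T2k k p q r)"
    unfolding T using len by force
  ultimately show ?thesis unfolding signed_graph_def by blast
qed

definition k_good :: "nat \<Rightarrow> int \<Rightarrow> int \<Rightarrow> int \<Rightarrow> bool" where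
  "k_good k p q r \<longleftrightarrow>
     (\<forall>s\<in>{p, q, r}. s \<noteq> 0 \<and> \<bar>s\<bar> \<le> int k) \<and> even (p + q + r) \<and>
     unbalanced_girth (T2k k p q r) = enat (2 * k)"

section \<open>The all $k$-good property\<close>

definition admissible :: "nat \<Rightarrow> 'a weighted_graph \<Rightarrow> bool" where
  "admissible k G \<longleftrightarrow>
     finite (wverts G) \<and>
     wedges G \<subseteq> {{u, v} |u v. u \<in> wverts G \<and> v \<in> wverts G \<and> u \<noteq> v} \<and>
     (\<forall>u v. {u, v} \<in> wedges G \<longrightarrow>
        weight G u v = weight G v u \<and> weight G u v \<noteq> 0 \<and> \<bar>weight G u v\<bar> \<le> int k) \<and>
     (\<exists>X Y. X \<union> Y = wverts G \<and> X \<inter> Y = {} \<and>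
        (\<forall>u v. {u, v} \<in> wedges G \<longrightarrow>
           (u \<in> X \<and> v \<in> Y \<longrightarrow> odd (weight G u v)) \<and>
           (u \<in> X \<and> v \<in> X \<or> u \<in> Y \<and> v \<in> Y \<longrightarrow> even (weight G u v))))"

text \<open>
  The values \<open>k\<close> and \<open>-k\<close> describe the same configuration, namely two paths of length \<open>k\<close>
  one of which is unbalanced: \<open>T2k k\<close> is unchanged, up to isomorphism, if an entry \<open>k\<close> is replaced
  by \<open>-k\<close>, and it is only by convention that an algebraic distance realised by a balanced and an
  unbalanced shortest path is positive.  A weight is therefore compared with an entry of a triple
  up to identifying \<open>k\<close> with \<open>-k\<close>.  With plain equality the property would fail for
  \<^term>\<open>complete_signed_distance_graph (SPC (2 * k - 1))\<close> for every \<open>k \<ge> 2\<close>: the triple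
  \<open>(2, k, -k)\<close> is \<open>k\<close>-good, but \<open>-k\<close> is not an algebraic distance in that graph.
\<close>

definition same_weight :: "nat \<Rightarrow> int \<Rightarrow> int \<Rightarrow> bool" where
  "same_weight k a b \<longleftrightarrow> a = b \<or> (\<bar>a\<bar> = int k \<and> \<bar>b\<bar> = int k)"

definition all_k_good :: "nat \<Rightarrow> 'a weighted_graph \<Rightarrow> bool" where
  "all_k_good k G \<longleftrightarrow>
     admissible k G \<and>
     (\<forall>u v. {u, v} \<in> wedges G \<longrightarrow>
       (\<forall>q r. k_good k (weight G u v) q r \<longrightarrow>
         (\<exists>z\<in>wverts G. {u, z} \<in> wedges G \<and> {v, z} \<in> wedges G \<and>
            (same_weight k (weight G u z) q \<and> same_weight k (weight G v z) r \<or>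
             same_weight k (weight G u z) (- q) \<and> same_weight k (weight G v z) (- r)))))"

end

theory Submission
  imports Defs
begin

text \<open>
  Reading every weight modulo \<open>2k\<close> removes the signs from the problem.  In \<open>SPC d\<close> with
  \<open>d = 2k - 1\<close>, a walk flips one coordinate along each positive edge and all of them along each
  negative edge.  Hence, if \<open>u\<close> and \<open>v\<close> are distinct and differ in \<open>m\<close> coordinates, a shortest
  balanced path between them has length \<open>m\<close> and a shortest unbalanced one length \<open>2k - m\<close>; the
  algebraic distance is the representative of \<open>m\<close> modulo \<open>2k\<close> in \<open>(-k, k]\<close>
  (\<open>alg_dist_SPC\<close>).

  Likewise, in \<open>T2k k p q r\<close> the two strands of a side of weight \<open>s\<close> are a balanced path of length
  \<open>s mod 2k\<close> and an unbalanced one of length \<open>2k - s mod 2k\<close>.  Let \<open>a, b, c\<close> be the three residues.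
  A cycle that runs once through each side is unbalanced if it uses one or three unbalanced
  strands.  Such cycles have length \<open>2k - a + b + c\<close> (and its two analogues) and
  \<open>6k - a - b - c\<close>, so unbalanced-girth \<open>2k\<close> forces the triangle inequalities
  for \<open>a, b, c\<close> together with \<open>a + b + c \<le> 4k\<close> (\<open>k_good_residues\<close>).

  Given \<open>u\<close> and \<open>v\<close> at Hamming distance \<open>a\<close>, a vertex at Hamming distances \<open>b\<close> and \<open>c\<close> from them
  exists as soon as the triangle inequalities hold, the sum is even, and
  \<open>a + b + c \<le> 2d = 4k - 2\<close> (\<open>exists_vertex_with_distances\<close>): flip suitably many coordinates inside
  and outside the set where \<open>u\<close> and \<open>v\<close> differ.  By parity the only triples left over have
  \<open>a + b + c = 4k\<close>.  For these the residues \<open>2k - b\<close> and \<open>2k - c\<close> of \<open>-q\<close> and \<open>-r\<close> work: here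
  \<open>a = (2k - b) + (2k - c)\<close>, the other two triangle inequalities turn into each other, and the
  perimeter is now \<open>2a \<le> 4k - 2\<close>.  This is where the second alternative of the
  all \<open>k\<close>-good property enters.
\<close>

section \<open>Walks and their signs\<close>

definition walk_sign :: "'a signed_graph \<Rightarrow> 'a list \<Rightarrow> int" where
  "walk_sign G xs = prod_list (map (edge_sign G) (walk_edges xs))"

lemma balanced_iff_walk_sign: "balanced G xs \<longleftrightarrow> walk_sign G xs = 1"
  by (simp add: balanced_def walk_sign_def)

lemma walk_edges_Nil [simp]: "walk_edges [] = []"
  and walk_edges_singleton [simp]: "walk_edges [x] = []"
  and walk_edges_Cons_Cons [simp]: "walk_edges (x # y # xs) = {x, y} # walk_edges (y # xs)"
  by (simp_all add: walk_edges_def)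

text \<open>
  Two walks are concatenated by dropping the first vertex of the second, which the first walk
  already ends in; lengths then add and signs multiply.
\<close>

lemma walk_edges_join:
  assumes "xs \<noteq> []" "ys \<noteq> []" "last xs = hd ys"
  shows "walk_edges (xs @ tl ys) = walk_edges xs @ walk_edges ys"
  using assms
proof (induction xs rule: induct_list012)
  case (2 x)
  then show ?case by (cases ys) auto
qed auto

lemma walk_edges_snoc:
  "xs \<noteq> [] \<Longrightarrow> walk_edges (xs @ [y]) = walk_edges xs @ [{last xs, y}]"
  using walk_edges_join[of xs "[last xs, y]"] by simp

lemma walk_edges_rev: "walk_edges (rev xs) = rev (walk_edges xs)"
proof (induction xs rule: induct_list012)
  case (3 x y zs)
  have "walk_edges (rev (x # y # zs)) = walk_edges (rev (y # zs)) @ [{y, x}]"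
    using walk_edges_snoc[of "rev (y # zs)" x] by simp
  then show ?case using 3 by (simp add: insert_commute)
qed simp_all

lemma walk_edges_map_upt:
  "walk_edges (map f [0..<Suc n]) = map (\<lambda>i. {f i, f (Suc i)}) [0..<n]"
proof (induction n)
  case (Suc n)
  have "walk_edges (map f [0..<Suc n] @ [f (Suc n)])
      = walk_edges (map f [0..<Suc n]) @ [{last (map f [0..<Suc n]), f (Suc n)}]"
    by (rule walk_edges_snoc) simp
  then show ?case using Suc by simp
qed simp

lemma walk_join:
  assumes "walk G xs" "walk G ys" "last xs = hd ys"
  shows "walk G (xs @ tl ys)"
  using assms walk_edges_join[of xs ys] by (auto simp: walk_def dest: list.set_sel(2))

lemma walk_rev: "walk G xs \<Longrightarrow> walk G (rev xs)"
  by (simp add: walk_def walk_edges_rev)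

lemma walk_length_join:
  assumes "walk G xs" "walk G ys" "last xs = hd ys"
  shows "walk_length (xs @ tl ys) = walk_length xs + walk_length ys"
  using assms walk_edges_join[of xs ys] by (simp add: walk_def walk_length_def)

lemma walk_sign_join:
  assumes "walk G xs" "walk G ys" "last xs = hd ys"
  shows "walk_sign G (xs @ tl ys) = walk_sign G xs * walk_sign G ys"
  using assms walk_edges_join[of xs ys] by (simp add: walk_def walk_sign_def)

lemma walk_length_rev: "walk_length (rev xs) = walk_length xs"
  by (simp add: walk_length_def walk_edges_rev)

lemma walk_sign_rev: "walk_sign G (rev xs) = walk_sign G xs"
proof -
  have "prod_list (rev ys) = prod_list ys" for ys :: "int list"
    by (induction ys) (simp_all add: mult.commute)
  then show ?thesis by (simp add: walk_sign_def walk_edges_rev rev_map[symmetric])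
qed

lemma walk_sign_cases: "walk_sign G xs = 1 \<or> walk_sign G xs = - 1"
proof -
  have "prod_list (map (edge_sign G) es) = 1 \<or> prod_list (map (edge_sign G) es) = - 1" for es
    by (induction es) (auto simp: edge_sign_def)
  then show ?thesis by (simp add: walk_sign_def)
qed

section \<open>Triangle inequalities for good triples\<close>

definition strand_list :: "nat \<Rightarrow> int \<Rightarrow> int \<Rightarrow> int \<Rightarrow> side \<Rightarrow> bool \<Rightarrow> tvertex list" where
  "strand_list k p q r e b =
     (let n = path_len k (side_value p q r e) b in map (path_vertex e b n) [0..<Suc n])"

lemma path_len_pos:
  assumes "k \<ge> 2" "s \<noteq> 0" "\<bar>s\<bar> \<le> int k"
  shows "0 < path_len k s b"
  using assms by (auto simp: path_len_def)

text \<open>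
  The negative edges of \<open>T2k\<close> are given as vertex sets, so the sign of a strand can only be read off
  once it is known that the first edge of a strand is not also an edge of another strand.
\<close>

lemma strand_edge_eqD:
  assumes "k \<ge> 2" "\<forall>e. side_value p q r e \<noteq> 0 \<and> \<bar>side_value p q r e\<bar> \<le> int k"
    and i: "i < path_len k (side_value p q r e) b"
    and eq: "{path_vertex e b (path_len k (side_value p q r e) b) i,
              path_vertex e b (path_len k (side_value p q r e) b) (Suc i)} =
             {path_vertex e' b' (path_len k (side_value p q r e') b') 0,
              path_vertex e' b' (path_len k (side_value p q r e') b') 1}"
  shows "i = 0 \<and> e = e' \<and> b = b'"
proof -
  define n where "n = path_len k (side_value p q r e) b"
  define n' where "n' = path_len k (side_value p q r e') b'"
  have n': "0 < n'" unfolding n'_def using assms(1,2) by (intro path_len_pos) auto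
  \<comment> \<open>Two strands of one side cannot both be single edges, since their lengths add up to \<open>2k\<close>.\<close>
  have short: "b = b'" if "e = e'" "n = 1" "n' = 1"
    using that assms(1) assms(2)[rule_format, of e]
    by (cases b; cases b') (auto simp: n_def n'_def path_len_def)
  have ends: "fst (side_ends e) \<noteq> snd (side_ends e)" for e by (cases e) auto
  have sides: "e = e'"
    if "{fst (side_ends e), snd (side_ends e)} = {fst (side_ends e'), snd (side_ends e')}"
    using that by (cases e; cases e'; simp add: doubleton_eq_iff)
  define X where "X = (if n' = 1 then Hub (snd (side_ends e')) else Inner e' b' 1)"
  have eq': "{path_vertex e b n i, path_vertex e b n (Suc i)} = {Hub (fst (side_ends e')), X}"
    using eq n' unfolding n_def[symmetric] n'_def[symmetric] by (simp add: path_vertex_def X_def)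
  have i: "i < n" using i by (simp add: n_def)
  show ?thesis
  proof (cases "n = 1")
    case True
    then have i0: "i = 0" using i by simp
    then have h: "{Hub (fst (side_ends e)), Hub (snd (side_ends e))} = {Hub (fst (side_ends e')), X}"
      using eq' True by (simp add: path_vertex_def)
    then have n'1: "n' = 1" by (auto simp: X_def doubleton_eq_iff split: if_splits)
    with h have "e = e'" by (intro sides) (auto simp: X_def doubleton_eq_iff)
    then show ?thesis using short True n'1 i0 by simp
  next
    case n: False
    show ?thesis
    proof (cases "i = 0")
      case True
      then have "{Hub (fst (side_ends e)), Inner e b 1} = {Hub (fst (side_ends e')), X}"
        using eq' n by (simp add: path_vertex_def)
      then have "X = Inner e b 1" by (simp add: doubleton_eq_iff)
      then show ?thesis using True by (simp add: X_def split: if_splits)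
    next
      case False
      then have h: "{Inner e b i, path_vertex e b n (Suc i)} = {Hub (fst (side_ends e')), X}"
        using eq' i by (simp add: path_vertex_def)
      then have "X = Inner e b i" and o: "path_vertex e b n (Suc i) = Hub (fst (side_ends e'))"
        by (simp_all add: doubleton_eq_iff)
      then have "e = e'" by (simp add: X_def split: if_splits)
      then show ?thesis using o ends[of e] by (simp add: path_vertex_def split: if_splits)
    qed
  qed
qed

lemma walk_strand_list:
  "walk (T2k k p q r) (strand_list k p q r e b)"
  unfolding walk_def strand_list_def Let_def walk_edges_map_upt
  by (auto simp: T2k_def Let_def less_Suc_eq_le simp del: upt_Suc) blast+

lemma walk_length_strand_list:
  "walk_length (strand_list k p q r e b) = path_len k (side_value p q r e) b"
  unfolding walk_length_def strand_list_def Let_def walk_edges_map_upt by simp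

lemma walk_sign_strand_list:
  assumes "k \<ge> 2" "\<forall>e. side_value p q r e \<noteq> 0 \<and> \<bar>side_value p q r e\<bar> \<le> int k"
  shows "walk_sign (T2k k p q r) (strand_list k p q r e b) =
    (if b \<longleftrightarrow> side_value p q r e < 0 then - 1 else 1)"
proof -
  define n where "n = path_len k (side_value p q r e) b"
  define f where "f = path_vertex e b n"
  let ?s = "edge_sign (T2k k p q r)"
  have n: "0 < n" unfolding n_def using assms by (intro path_len_pos) auto
  have edge: "{f i, f (Suc i)} \<in> negs (T2k k p q r) \<longleftrightarrow> i = 0 \<and> (b \<longleftrightarrow> side_value p q r e < 0)"
    if i: "i < n" for i
  proof
    assume "{f i, f (Suc i)} \<in> negs (T2k k p q r)"
    then obtain e' b' where e': "{f i, f (Suc i)} =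
        {path_vertex e' b' (path_len k (side_value p q r e') b') 0,
         path_vertex e' b' (path_len k (side_value p q r e') b') 1}"
      and b': "b' \<longleftrightarrow> side_value p q r e' < 0"
      by (auto simp: T2k_def Let_def)
    from strand_edge_eqD[OF assms i[unfolded n_def] e'[unfolded f_def n_def]] b'
    show "i = 0 \<and> (b \<longleftrightarrow> side_value p q r e < 0)" by simp
  next
    assume "i = 0 \<and> (b \<longleftrightarrow> side_value p q r e < 0)"
    then show "{f i, f (Suc i)} \<in> negs (T2k k p q r)"
      by (auto simp: T2k_def Let_def f_def n_def)
  qed
  have "walk_sign (T2k k p q r) (strand_list k p q r e b)
      = prod_list (map (\<lambda>i. ?s {f i, f (Suc i)}) [0..<n])"
    unfolding walk_sign_def strand_list_def Let_def n_def[symmetric] f_def[symmetric]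
      walk_edges_map_upt by (simp add: o_def)
  also have "\<dots> = (\<Prod>i<n. ?s {f i, f (Suc i)})"
    by (simp add: prod.list_conv_set_nth lessThan_atLeast0)
  also have "\<dots> = (\<Prod>i<n. if i = 0 then ?s {f 0, f 1} else 1)"
    by (rule prod.cong) (use edge in \<open>auto simp: edge_sign_def\<close>)
  also have "\<dots> = ?s {f 0, f 1}"
    using n by simp
  also have "\<dots> = (if b \<longleftrightarrow> side_value p q r e < 0 then - 1 else 1)"
    using edge[OF n] by (simp add: edge_sign_def)
  finally show ?thesis .
qed

text \<open>
  In this form the end vertices and the disjointness of different strands are visible.
\<close>

lemma strand_list_eq:
  assumes "0 < path_len k (side_value p q r e) b"
  shows "strand_list k p q r e b =
    Hub (fst (side_ends e)) # map (Inner e b) [1..<path_len k (side_value p q r e) b] @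
    [Hub (snd (side_ends e))]"
proof -
  define n where "n = path_len k (side_value p q r e) b"
  have n: "0 < n" using assms by (simp add: n_def)
  then have "[0..<Suc n] = 0 # [1..<n] @ [n]" by (simp add: upt_conv_Cons)
  moreover have "map (path_vertex e b n) [1..<n] = map (Inner e b) [1..<n]"
    by (simp add: path_vertex_def)
  ultimately show ?thesis
    unfolding strand_list_def Let_def n_def[symmetric] using n by (simp add: path_vertex_def)
qed

text \<open>
  The flags \<open>x\<close>, \<open>y\<close>, \<open>z\<close> select one strand of each side, and the strand \<open>x\<close> of the side of weight \<open>p\<close>
  is unbalanced exactly if \<open>x = (p < 0)\<close>.  The three selected strands form a cycle, which is
  unbalanced if an odd number of them is; the hypothesis \<open>odd\<close> says this as an exclusive or.
\<close>

lemma k_good_strand_cycle: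
  assumes "k \<ge> 2" "k_good k p q r"
    and odd: "((x \<longleftrightarrow> p < 0) \<noteq> (y \<longleftrightarrow> q < 0)) \<noteq> (z \<longleftrightarrow> r < 0)"
  shows "2 * k \<le> path_len k p x + path_len k q y + path_len k r z"
proof -
  let ?G = "T2k k p q r"
  have val: "\<forall>e. side_value p q r e \<noteq> 0 \<and> \<bar>side_value p q r e\<bar> \<le> int k"
  proof
    fix e show "side_value p q r e \<noteq> 0 \<and> \<bar>side_value p q r e\<bar> \<le> int k"
      using assms(2) by (cases e) (auto simp: k_good_def)
  qed
  have len: "0 < path_len k (side_value p q r e) b" for e b
    using assms(1) val by (intro path_len_pos) auto
  define P where "P = strand_list k p q r UV x"
  define Q where "Q = strand_list k p q r UW y"
  define R where "R = strand_list k p q r VW z"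
  note eqs = strand_list_eq[OF len, of UV x, folded P_def]
    strand_list_eq[OF len, of UW y, folded Q_def] strand_list_eq[OF len, of VW z, folded R_def]
  \<comment> \<open>The strand between \<open>u\<close> and \<open>w\<close> is listed from \<open>u\<close>, so the cycle runs through it backwards.\<close>
  have PR: "last P = hd R" and RQ: "last R = hd (rev Q)" and QP: "last (rev Q) = hd P"
    and ne: "P \<noteq> []" "Q \<noteq> []" "R \<noteq> []"
    by (simp_all add: eqs)
  have w: "walk ?G P" "walk ?G (rev Q)" "walk ?G R"
    by (simp_all add: P_def Q_def R_def walk_rev walk_strand_list)
  have "tl R \<noteq> []"
    by (simp add: eqs)
  then have PRQ: "last (P @ tl R) = hd (rev Q)" using RQ by (simp add: last_tl)
  define C where "C = (P @ tl R) @ tl (rev Q)"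
  have wPR: "walk ?G (P @ tl R)" using w PR by (simp add: walk_join)
  have wC: "walk ?G C"
    unfolding C_def using wPR w(2) PRQ by (rule walk_join)
  have lC: "walk_length C = path_len k p x + path_len k r z + path_len k q y"
    unfolding C_def walk_length_join[OF wPR w(2) PRQ] walk_length_join[OF w(1) w(3) PR]
      walk_length_rev by (simp add: P_def Q_def R_def walk_length_strand_list)
  have "walk_sign ?G C = walk_sign ?G P * walk_sign ?G R * walk_sign ?G Q"
    unfolding C_def walk_sign_join[OF wPR w(2) PRQ] walk_sign_join[OF w(1) w(3) PR]
      walk_sign_rev ..
  also have "\<dots> = - 1"
    unfolding P_def Q_def R_def walk_sign_strand_list[OF assms(1) val] side_value.simps
    using odd by (cases "x = (p < 0)"; cases "y = (q < 0)"; cases "z = (r < 0)") simp_all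
  finally have unb: "\<not> balanced ?G C" by (simp add: balanced_iff_walk_sign)
  have "tl C = tl P @ tl R @ tl (rev Q)"
    using ne by (simp add: C_def)
  moreover have "distinct (tl P @ tl R @ tl (rev Q))"
    by (auto simp: eqs distinct_map inj_on_def)
  moreover have "last C = hd C"
  proof -
    have "tl (rev Q) \<noteq> []" by (simp add: eqs)
    then show ?thesis using QP ne by (simp add: C_def last_tl)
  qed
  moreover have "3 \<le> walk_length C"
    using len[of UV x] len[of UW y] len[of VW z] by (simp add: lC)
  ultimately have "cycle ?G C" using wC by (simp add: cycle_def)
  with unb have "unbalanced_girth ?G \<le> enat (walk_length C)"
    unfolding unbalanced_girth_def by (intro INF_lower) simp
  then show ?thesis using assms(2) lC by (simp add: k_good_def)
qed

definition residue :: "nat \<Rightarrow> int \<Rightarrow> nat" where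
  "residue k s = nat (s mod (2 * int k))"

lemma residue_eq:
  assumes "s \<noteq> 0" "\<bar>s\<bar> \<le> int k"
  shows "int (residue k s) = (if 0 < s then s else 2 * int k + s)"
proof (cases "0 < s")
  case False
  then have "s mod (2 * int k) = (2 * int k + s) mod (2 * int k)" by simp
  also have "\<dots> = 2 * int k + s" using False assms by (intro mod_pos_pos_trivial) auto
  finally show ?thesis using False assms by (simp add: residue_def)
qed (use assms in \<open>simp add: residue_def\<close>)

lemma path_len_residue:
  assumes "s \<noteq> 0" "\<bar>s\<bar> \<le> int k"
  shows "int (path_len k s (0 < s)) = int (residue k s)"
    and "int (path_len k s (s < 0)) = 2 * int k - int (residue k s)"
  using assms by (auto simp: residue_eq path_len_def)

text \<open>
  The four inequalities come from the four unbalanced cycles through all three sides: those with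
  one unbalanced strand give the triangle inequalities, the one with three gives the bound on the
  perimeter.
\<close>

lemma k_good_residues:
  assumes "k \<ge> 2" "k_good k p q r"
  defines "a \<equiv> residue k p" and "b \<equiv> residue k q" and "c \<equiv> residue k r"
  shows "a \<le> b + c" "b \<le> a + c" "c \<le> a + b" "a + b + c \<le> 4 * k" "even (a + b + c)"
proof -
  have nz: "p \<noteq> 0" "q \<noteq> 0" "r \<noteq> 0" and le: "\<bar>p\<bar> \<le> int k" "\<bar>q\<bar> \<le> int k" "\<bar>r\<bar> \<le> int k"
    and ev: "even (p + q + r)"
    using assms(2) by (auto simp: k_good_def)
  note len = path_len_residue[OF nz(1) le(1)] path_len_residue[OF nz(2) le(2)]
    path_len_residue[OF nz(3) le(3)]
  note cyc = k_good_strand_cycle[OF assms(1,2)]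
  have "2 * k \<le> path_len k p (p < 0) + path_len k q (0 < q) + path_len k r (0 < r)"
    using nz by (intro cyc) auto
  then show "a \<le> b + c" unfolding a_def b_def c_def using len by linarith
  have "2 * k \<le> path_len k p (0 < p) + path_len k q (q < 0) + path_len k r (0 < r)"
    using nz by (intro cyc) auto
  then show "b \<le> a + c" unfolding a_def b_def c_def using len by linarith
  have "2 * k \<le> path_len k p (0 < p) + path_len k q (0 < q) + path_len k r (r < 0)"
    using nz by (intro cyc) auto
  then show "c \<le> a + b" unfolding a_def b_def c_def using len by linarith
  have "2 * k \<le> path_len k p (p < 0) + path_len k q (q < 0) + path_len k r (r < 0)"
    using nz by (intro cyc) auto
  then show "a + b + c \<le> 4 * k" unfolding a_def b_def c_def using len by linarith
  have "even (int (a + b + c))"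
    using ev nz le by (auto simp: a_def b_def c_def residue_eq)
  then show "even (a + b + c)" by simp
qed

section \<open>Distances in signed projective cubes\<close>

definition diff_set :: "(nat \<Rightarrow> bit) \<Rightarrow> (nat \<Rightarrow> bit) \<Rightarrow> nat set" where
  "diff_set u v = {i. u i \<noteq> v i}"

abbreviation hamming :: "(nat \<Rightarrow> bit) \<Rightarrow> (nat \<Rightarrow> bit) \<Rightarrow> nat" where
  "hamming u v \<equiv> card (diff_set u v)"

lemma verts_SPC [simp]: "verts (SPC d) = bit_vectors d"
  by (simp add: SPC_def)

lemma diff_set_commute: "diff_set u v = diff_set v u"
  by (auto simp: diff_set_def)

lemma diff_set_subset: "u \<in> bit_vectors d \<Longrightarrow> v \<in> bit_vectors d \<Longrightarrow> diff_set u v \<subseteq> {..<d}"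
proof
  fix i
  assume "u \<in> bit_vectors d" "v \<in> bit_vectors d" "i \<in> diff_set u v"
  then show "i \<in> {..<d}" by (cases "i < d") (simp_all add: diff_set_def bit_vectors_def)
qed

lemma finite_diff_set: "u \<in> bit_vectors d \<Longrightarrow> v \<in> bit_vectors d \<Longrightarrow> finite (diff_set u v)"
  by (rule finite_subset[OF diff_set_subset]) auto

lemma hamming_le: "u \<in> bit_vectors d \<Longrightarrow> v \<in> bit_vectors d \<Longrightarrow> hamming u v \<le> d"
  using card_mono[OF _ diff_set_subset[of u d v]] by simp

lemma hamming_eq_0_iff:
  "u \<in> bit_vectors d \<Longrightarrow> v \<in> bit_vectors d \<Longrightarrow> hamming u v = 0 \<longleftrightarrow> u = v"
  using finite_diff_set by (auto simp: diff_set_def)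

text \<open>
  Over a field with two elements \<open>u\<close> and \<open>v\<close> differ in a coordinate exactly if \<open>w\<close> differs there from
  just one of them.
\<close>

lemma diff_set_eq_sym_diff: "diff_set u v = sym_diff (diff_set u w) (diff_set w v)"
proof -
  have "x \<noteq> z \<longleftrightarrow> (x \<noteq> y) \<noteq> (y \<noteq> z)" for x y z :: bit
    by (cases x; cases y; cases z) auto
  then show ?thesis by (auto simp: diff_set_def)
qed

lemma card_sym_diff:
  assumes "finite A" "finite B"
  shows "int (card (sym_diff A B)) = int (card A) + int (card B) - 2 * int (card (A \<inter> B))"
proof -
  have "card (sym_diff A B) = card (A - B) + card (B - A)"
    using assms by (intro card_Un_disjoint) auto
  then show ?thesis
    using card_Int_Diff[OF assms(1), of B] card_Int_Diff[OF assms(2), of A]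
    by (simp add: Int_commute)
qed

lemma diff_eq_unit_vector_iff: "u - v = unit_vector i \<longleftrightarrow> diff_set u v = {i}"
proof -
  have "(u - v) j = unit_vector i j \<longleftrightarrow> (u j \<noteq> v j \<longleftrightarrow> j = i)" for j
    by (cases "u j"; cases "v j") (auto simp: unit_vector_def)
  then show ?thesis by (auto simp: fun_eq_iff diff_set_def set_eq_iff)
qed

lemma diff_eq_all_ones_iff: "u - v = all_ones d \<longleftrightarrow> diff_set u v = {..<d}"
proof -
  have "(u - v) j = all_ones d j \<longleftrightarrow> (u j \<noteq> v j \<longleftrightarrow> j < d)" for j
    by (cases "u j"; cases "v j") (auto simp: all_ones_def)
  then show ?thesis by (auto simp: fun_eq_iff diff_set_def set_eq_iff)
qed

lemma doubleton_diff_set_iff: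
  "(\<exists>x y. {u, v} = {x, y} \<and> x \<in> B \<and> y \<in> B \<and> P (diff_set x y)) \<longleftrightarrow>
     u \<in> B \<and> v \<in> B \<and> P (diff_set u v)"
  unfolding doubleton_eq_iff using diff_set_commute[of u v] by metis

lemma edges_SPC_iff:
  "{u, v} \<in> edges (SPC d) \<longleftrightarrow> u \<in> bit_vectors d \<and> v \<in> bit_vectors d \<and>
     ((\<exists>i<d. diff_set u v = {i}) \<or> diff_set u v = {..<d})"
proof -
  have "x - y \<in> unit_vector ` {0..<d} \<union> {all_ones d} \<longleftrightarrow>
      (\<exists>i<d. diff_set x y = {i}) \<or> diff_set x y = {..<d}" for x y
    unfolding diff_eq_unit_vector_iff[symmetric] diff_eq_all_ones_iff[symmetric]
    by (simp add: image_iff Bex_def disj_commute)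
  then show ?thesis
    unfolding SPC_def signed_graph.simps mem_Collect_eq
    by (simp only: doubleton_diff_set_iff[where P = "\<lambda>D. (\<exists>i<d. D = {i}) \<or> D = {..<d}"])
qed

lemma negs_SPC_iff:
  "{u, v} \<in> negs (SPC d) \<longleftrightarrow> u \<in> bit_vectors d \<and> v \<in> bit_vectors d \<and> diff_set u v = {..<d}"
  unfolding SPC_def signed_graph.simps mem_Collect_eq diff_eq_all_ones_iff
  by (rule doubleton_diff_set_iff)

text \<open>
  A positive first edge changes the Hamming distance to \<open>v\<close> by at most one; a negative one replaces
  it by \<open>d\<close> minus itself and exchanges the two cases of the claim.  This is why both bounds
  have to be proved in one induction.
\<close>

lemma SPC_walk_length_ge:
  assumes "walk (SPC d) xs" "hd xs = u" "last xs = v"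
  shows "if walk_sign (SPC d) xs = 1 then hamming u v \<le> walk_length xs
         else d + 1 \<le> hamming u v + walk_length xs"
  using assms
proof (induction xs arbitrary: u rule: induct_list012)
  case 1
  then show ?case unfolding walk_def by blast
next
  case (2 x)
  then show ?case by (simp add: walk_sign_def diff_set_def)
next
  case (3 x y zs)
  let ?s = "walk_sign (SPC d) (y # zs)" and ?n = "walk_length (y # zs)"
  have ux: "u = x" and V: "x \<in> bit_vectors d" "y \<in> bit_vectors d" "v \<in> bit_vectors d"
    and e: "{x, y} \<in> edges (SPC d)" and w: "walk (SPC d) (y # zs)" and l: "last (y # zs) = v"
    using 3(3-5) last_in_set[of "y # zs"] by (auto simp: walk_def split: if_splits)
  have IH: "if ?s = 1 then hamming y v \<le> ?n else d + 1 \<le> hamming y v + ?n"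
    by (rule 3(2)[OF w _ l]) simp
  have len: "walk_length (x # y # zs) = Suc ?n" by (simp add: walk_length_def)
  have sgn: "walk_sign (SPC d) (x # y # zs) = edge_sign (SPC d) {x, y} * ?s"
    by (simp add: walk_sign_def)
  note fin = finite_diff_set[OF V(1,2)] finite_diff_set[OF V(2,3)]
  have c: "int (hamming x v) = int (hamming x y) + int (hamming y v)
      - 2 * int (card (diff_set x y \<inter> diff_set y v))"
    using card_sym_diff[OF fin] diff_set_eq_sym_diff[of x v y] by simp
  show ?case
  proof (cases "diff_set x y = {..<d}")
    case True
    then have "edge_sign (SPC d) {x, y} = - 1" using V by (simp add: edge_sign_def negs_SPC_iff)
    moreover have "diff_set x y \<inter> diff_set y v = diff_set y v"
      using True diff_set_subset[OF V(2,3)] by auto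
    then have "hamming x v + hamming y v = d" using c True by simp
    ultimately show ?thesis
      using IH walk_sign_cases[of "SPC d" "y # zs"] unfolding ux len sgn by auto
  next
    case False
    then have "edge_sign (SPC d) {x, y} = 1" by (simp add: edge_sign_def negs_SPC_iff)
    moreover obtain i where "diff_set x y = {i}" using e False unfolding edges_SPC_iff by blast
    then have one: "hamming x y = 1" by simp
    moreover have "card (diff_set x y \<inter> diff_set y v) \<le> hamming x y"
      using fin by (intro card_mono) auto
    ultimately show ?thesis
      using IH c walk_sign_cases[of "SPC d" "y # zs"] unfolding ux len sgn one
      by (cases "?s = 1") simp_all
  qed
qed

text \<open>
  The differing coordinates are corrected one at a time.  The last conjunct, that no correct
  coordinate is ever touched, shows that no vertex is repeated, here and when the path is extended
  by a negative edge.
\<close>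

lemma SPC_positive_path:
  assumes "u \<in> bit_vectors d" "v \<in> bit_vectors d" "d \<ge> 2"
  shows "\<exists>xs. path_between (SPC d) u v xs \<and> walk_length xs = hamming u v \<and>
    walk_sign (SPC d) xs = 1 \<and> (\<forall>x\<in>set xs. diff_set x v \<subseteq> diff_set u v)"
  using assms(1)
proof (induction "hamming u v" arbitrary: u)
  case 0
  have "u = v" by (rule iffD1[OF hamming_eq_0_iff[OF 0(2) assms(2)] 0(1)[symmetric]])
  then have "path_between (SPC d) u v [v]" "walk_length [v] = hamming u v"
    "walk_sign (SPC d) [v] = 1" "\<forall>x\<in>set [v]. diff_set x v \<subseteq> diff_set u v"
    using assms(2) by (simp_all add: path_between_def walk_def walk_length_def walk_sign_def diff_set_def)
  then show ?case by blast
next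
  case (Suc n)
  from Suc(2) obtain i where i: "i \<in> diff_set u v" by (metis card.empty ex_in_conv nat.distinct(1))
  then have id: "i < d" using diff_set_subset[OF Suc(3) assms(2)] by auto
  define y where "y = u(i := v i)"
  have y: "y \<in> bit_vectors d" using id Suc(3) by (auto simp: y_def bit_vectors_def)
  have uy: "diff_set u y = {i}" using i by (auto simp: y_def diff_set_def)
  have yv: "diff_set y v = diff_set u v - {i}" by (auto simp: y_def diff_set_def)
  have "n = hamming y v" using Suc(2) i unfolding yv by simp
  from Suc(1)[OF this y] obtain xs where xs: "path_between (SPC d) y v xs"
      "walk_length xs = hamming y v" "walk_sign (SPC d) xs = 1"
      "\<forall>x\<in>set xs. diff_set x v \<subseteq> diff_set y v" by blast
  obtain ys where ys: "xs = y # ys" using xs(1) by (cases xs) (auto simp: path_between_def walk_def)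
  have e: "{u, y} \<in> edges (SPC d)" using Suc(3) y uy id by (auto simp: edges_SPC_iff)
  have "{i} \<noteq> {..<d}"
  proof
    assume "{i} = {..<d}"
    then have "card {i} = card {..<d}" by (rule arg_cong)
    then show False using assms(3) by simp
  qed
  then have s: "edge_sign (SPC d) {u, y} = 1" using uy by (simp add: edge_sign_def negs_SPC_iff)
  have "u \<notin> set xs" using xs(4) i yv by auto
  then have "path_between (SPC d) u v (u # xs)"
    using xs(1) e Suc(3) by (simp add: path_between_def walk_def ys)
  moreover have "walk_length (u # xs) = hamming u v"
    using xs(2) \<open>n = hamming y v\<close> Suc(2) by (simp add: ys walk_length_def)
  moreover have "walk_sign (SPC d) (u # xs) = 1"
    using xs(3) s by (simp add: ys walk_sign_def)
  moreover have "\<forall>x\<in>set (u # xs). diff_set x v \<subseteq> diff_set u v"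
    using xs(4) yv by auto
  ultimately show ?case by blast
qed

text \<open>
  The path starts with the negative edge to the antipode of \<open>u\<close>, which differs from \<open>v\<close> in the
  complementary set of coordinates.  It never returns to \<open>u\<close>, because a coordinate in which \<open>u\<close>
  differs from \<open>v\<close> is already correct after the first step.
\<close>

lemma SPC_negative_path:
  assumes "u \<in> bit_vectors d" "v \<in> bit_vectors d" "d \<ge> 2" "u \<noteq> v"
  shows "\<exists>xs. path_between (SPC d) u v xs \<and> walk_length xs = Suc d - hamming u v \<and>
    walk_sign (SPC d) xs = - 1"
proof -
  define y where "y = (\<lambda>i. if i < d then u i + 1 else 0)"
  have y: "y \<in> bit_vectors d" by (simp add: y_def bit_vectors_def)
  have uy: "diff_set u y = {..<d}" using assms(1) by (auto simp: diff_set_def y_def bit_vectors_def)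
  have yv: "diff_set y v = {..<d} - diff_set u v"
  proof -
    have "diff_set y v = sym_diff {..<d} (diff_set u v)"
      using diff_set_eq_sym_diff[of y v u] uy by (simp add: diff_set_commute[of y u])
    then show ?thesis using diff_set_subset[OF assms(1,2)] by auto
  qed
  have h: "hamming y v = d - hamming u v"
    unfolding yv using diff_set_subset[OF assms(1,2)] finite_diff_set[OF assms(1,2)]
    by (simp add: card_Diff_subset)
  from SPC_positive_path[OF y assms(2,3)] obtain xs where xs: "path_between (SPC d) y v xs"
      "walk_length xs = hamming y v" "walk_sign (SPC d) xs = 1"
      "\<forall>x\<in>set xs. diff_set x v \<subseteq> diff_set y v" by blast
  obtain ys where ys: "xs = y # ys" using xs(1) by (cases xs) (auto simp: path_between_def walk_def)
  have e: "{u, y} \<in> edges (SPC d)" using assms(1) y uy by (simp add: edges_SPC_iff)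
  have s: "edge_sign (SPC d) {u, y} = - 1"
    using assms(1) y uy by (simp add: edge_sign_def negs_SPC_iff)
  have "diff_set u v \<noteq> {}" using assms(4) by (auto simp: diff_set_def)
  then have "u \<notin> set xs" using xs(4) yv by auto
  then have "path_between (SPC d) u v (u # xs)"
    using xs(1) e assms(1) by (simp add: path_between_def walk_def ys)
  moreover have "walk_length (u # xs) = Suc d - hamming u v"
    using xs(2) h hamming_le[OF assms(1,2)] by (simp add: ys walk_length_def)
  moreover have "walk_sign (SPC d) (u # xs) = - 1"
    using xs(3) s by (simp add: ys walk_sign_def)
  ultimately show ?thesis by blast
qed

text \<open>
  The representative of \<open>m < 2k\<close> modulo \<open>2k\<close> in the interval \<open>(-k, k]\<close>; at \<open>m = k\<close> there are balanced
  and unbalanced shortest paths, and the algebraic distance is then positive.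
\<close>

definition signed_residue :: "nat \<Rightarrow> nat \<Rightarrow> int" where
  "signed_residue k m = (if m \<le> k then int m else int m - 2 * int k)"

lemma alg_dist_SPC:
  assumes k: "k \<ge> 2" "Suc d = 2 * k" and uv: "u \<in> bit_vectors d" "v \<in> bit_vectors d" "u \<noteq> v"
  shows "alg_dist (SPC d) u v = signed_residue k (hamming u v)"
proof -
  let ?G = "SPC d"
  define m where "m = hamming u v"
  have d: "d \<ge> 2" using k by simp
  have m: "m < 2 * k" using hamming_le[OF uv(1,2)] k by (simp add: m_def)
  obtain xs where xs: "path_between ?G u v xs" "walk_length xs = m" "walk_sign ?G xs = 1"
    using SPC_positive_path[OF uv(1,2) d] by (auto simp: m_def)
  obtain ys where ys: "path_between ?G u v ys" "walk_length ys = 2 * k - m" "walk_sign ?G ys = - 1"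
    using SPC_negative_path[OF uv(1,2) d uv(3)] k(2) by (auto simp: m_def)
  have lower: "if walk_sign ?G zs = 1 then m \<le> walk_length zs else 2 * k \<le> m + walk_length zs"
    if "path_between ?G u v zs" for zs
    using SPC_walk_length_ge[of d zs u v] that k(2)
    by (auto simp: path_between_def m_def split: if_splits)
  have dist: "graph_dist ?G u v = min m (2 * k - m)"
    unfolding graph_dist_def
  proof (rule Least_equality)
    show "\<exists>zs. path_between ?G u v zs \<and> walk_length zs = min m (2 * k - m)"
      using xs ys unfolding min_def by auto
    fix n assume "\<exists>zs. path_between ?G u v zs \<and> walk_length zs = n"
    then show "min m (2 * k - m) \<le> n" using lower by (fastforce split: if_splits)
  qed
  show ?thesis
  proof (cases "m \<le> k")
    case True
    then have "graph_dist ?G u v = m" using dist by simp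
    then show ?thesis using xs True
      by (auto simp: alg_dist_def signed_residue_def balanced_iff_walk_sign m_def)
  next
    case False
    then have g: "graph_dist ?G u v = 2 * k - m" using dist by simp
    have "\<not> (\<exists>zs. path_between ?G u v zs \<and> walk_length zs = graph_dist ?G u v \<and> balanced ?G zs)"
      using lower False unfolding g balanced_iff_walk_sign by fastforce
    then have "alg_dist ?G u v = - int (2 * k - m)" unfolding alg_dist_def g by (rule if_not_P)
    then show ?thesis using False m by (simp add: signed_residue_def m_def)
  qed
qed

lemma residue_signed_residue:
  assumes "0 < m" "m < 2 * k"
  shows "residue k (signed_residue k m) = m"
  using assms residue_eq[of "signed_residue k m" k] by (auto simp: signed_residue_def split: if_splits)

text \<open>
  The residue of \<open>-k\<close> is \<open>k\<close>, whose signed representative is \<open>k\<close>: only at this weight does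
  the identification of \<open>k\<close> with \<open>-k\<close> matter.
\<close>

lemma same_weight_signed_residue:
  assumes "s \<noteq> 0" "\<bar>s\<bar> \<le> int k"
  shows "same_weight k (signed_residue k (residue k s)) s"
    and "same_weight k (signed_residue k (2 * k - residue k s)) (- s)"
  using residue_eq[OF assms] assms by (auto simp: same_weight_def signed_residue_def of_nat_diff split: if_splits)

section \<open>Triangles in signed projective cubes\<close>

lemma exists_vertex_with_distances:
  assumes "u \<in> bit_vectors d" "v \<in> bit_vectors d"
    and "hamming u v \<le> b + c" "b \<le> hamming u v + c" "c \<le> hamming u v + b"
    and "hamming u v + b + c \<le> 2 * d" "even (hamming u v + b + c)"
  shows "\<exists>z\<in>bit_vectors d. hamming u z = b \<and> hamming v z = c"
proof -
  define a where "a = hamming u v"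
  define D where "D = diff_set u v"
  note D = diff_set_subset[OF assms(1,2), folded D_def] finite_diff_set[OF assms(1,2), folded D_def]
  \<comment> \<open>With \<open>x\<close> flips inside \<open>D\<close> and \<open>y\<close> outside, \<open>z\<close> has distance \<open>x + y\<close> from \<open>u\<close> and
      \<open>(a - x) + y\<close> from \<open>v\<close>; equating these with \<open>b\<close> and \<open>c\<close> determines \<open>x\<close> and \<open>y\<close>.\<close>
  define x where "x = (a + b - c) div 2"
  define y where "y = (b + c - a) div 2"
  have xy: "x + y = b" "x \<le> a" "a - x + y = c" "y \<le> d - a"
  proof -
    have "2 * x + c = a + b" "2 * y + a = b + c"
      using assms(3,5,7) unfolding a_def[symmetric] x_def y_def by presburger+
    then show "x + y = b" "x \<le> a" "a - x + y = c" "y \<le> d - a"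
      using assms(3-6) unfolding a_def[symmetric] by linarith+
  qed
  obtain S where S: "S \<subseteq> D" "card S = x"
    by (rule obtain_subset_with_card_n[OF xy(2)[unfolded a_def D_def[symmetric]]])
  have "card ({..<d} - D) = d - a" using D by (simp add: card_Diff_subset a_def D_def)
  then have "y \<le> card ({..<d} - D)" using xy(4) by simp
  then obtain T where T: "T \<subseteq> {..<d} - D" "card T = y"
    by (rule obtain_subset_with_card_n)
  define z where "z = (\<lambda>i. if i \<in> S \<union> T then u i + 1 else u i)"
  have uz: "diff_set u z = S \<union> T" by (auto simp: diff_set_def z_def)
  have "diff_set v z = sym_diff D (S \<union> T)"
    using diff_set_eq_sym_diff[of v z u] uz by (simp add: D_def diff_set_commute[of v u])
  then have vz: "diff_set v z = (D - S) \<union> T" using S T by auto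
  have fin: "finite S" "finite T"
    using finite_subset[OF S(1) D(2)] finite_subset[OF T(1)] by simp_all
  have "S \<union> T \<subseteq> {..<d}" using S T D by auto
  then have "z \<in> bit_vectors d" using assms(1) by (auto simp: z_def bit_vectors_def)
  moreover have "hamming u z = b"
    using S T fin xy(1) unfolding uz by (subst card_Un_disjoint) auto
  moreover have "hamming v z = c"
  proof -
    have "card ((D - S) \<union> T) = card (D - S) + card T"
      using T D fin by (intro card_Un_disjoint) auto
    also have "card (D - S) = a - x" using S fin by (simp add: card_Diff_subset a_def D_def)
    finally show ?thesis using T xy(3) vz by simp
  qed
  ultimately show ?thesis by blast
qed

text \<open>
  The bipartition is by the parity of the number of nonzero coordinates.
\<close>

lemma admissible_SPC:
  assumes k: "k \<ge> 2" "Suc d = 2 * k"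
  shows "admissible k (complete_signed_distance_graph (SPC d))"
proof -
  let ?W = "complete_signed_distance_graph (SPC d)"
  let ?w = "alg_dist (SPC d)"
  have w: "?w u v = signed_residue k (hamming u v)" "0 < hamming u v" "hamming u v < 2 * k"
    if "u \<in> bit_vectors d" "v \<in> bit_vectors d" "u \<noteq> v" for u v
    using that k alg_dist_SPC[OF k that] hamming_eq_0_iff[of u d v] hamming_le[of u d v] by auto
  have par: "even (signed_residue k m) \<longleftrightarrow> even m" for m
    by (simp add: signed_residue_def)
  define X where "X = {u \<in> bit_vectors d. even (hamming u 0)}"
  define Y where "Y = {u \<in> bit_vectors d. odd (hamming u 0)}"
  have zero: "0 \<in> bit_vectors d" by (simp add: bit_vectors_def)
  have ev: "even (hamming u v) \<longleftrightarrow> (even (hamming u 0) \<longleftrightarrow> even (hamming v 0))"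
    if "u \<in> bit_vectors d" "v \<in> bit_vectors d" for u v
  proof -
    have "int (hamming u v) = int (hamming u 0) + int (hamming v 0)
        - 2 * int (card (diff_set u 0 \<inter> diff_set v 0))"
      using card_sym_diff[OF finite_diff_set[OF that(1) zero] finite_diff_set[OF that(2) zero]]
        diff_set_eq_sym_diff[of u v 0] by (simp add: diff_set_commute[of 0 v])
    then have "even (int (hamming u v)) \<longleftrightarrow> even (int (hamming u 0) + int (hamming v 0))" by simp
    then show ?thesis by auto
  qed
  have W: "wverts ?W = bit_vectors d" "weight ?W = alg_dist (SPC d)"
    "wedges ?W = {{u, v} |u v. u \<in> bit_vectors d \<and> v \<in> bit_vectors d \<and> u \<noteq> v}"
    by (simp_all add: complete_signed_distance_graph_def)
  have wedges: "u \<in> bit_vectors d" "v \<in> bit_vectors d" "u \<noteq> v" if "{u, v} \<in> wedges ?W" for u v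
    using that unfolding W by (auto simp: doubleton_eq_iff)
  show ?thesis
    unfolding admissible_def
  proof (intro conjI allI impI)
    show "finite (wverts ?W)"
      using signed_graph_SPC[of d] k by (simp add: signed_graph_def W)
    show "wedges ?W \<subseteq> {{u, v} |u v. u \<in> wverts ?W \<and> v \<in> wverts ?W \<and> u \<noteq> v}"
      by (simp add: W)
    have "X \<union> Y = wverts ?W \<and> X \<inter> Y = {} \<and> (\<forall>u v. {u, v} \<in> wedges ?W \<longrightarrow>
        (u \<in> X \<and> v \<in> Y \<longrightarrow> odd (weight ?W u v)) \<and>
        (u \<in> X \<and> v \<in> X \<or> u \<in> Y \<and> v \<in> Y \<longrightarrow> even (weight ?W u v)))"
    proof (intro conjI allI)
      show "X \<union> Y = wverts ?W" "X \<inter> Y = {}" by (auto simp: X_def Y_def W)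
      show "{u, v} \<in> wedges ?W \<longrightarrow> (u \<in> X \<and> v \<in> Y \<longrightarrow> odd (weight ?W u v)) \<and>
        (u \<in> X \<and> v \<in> X \<or> u \<in> Y \<and> v \<in> Y \<longrightarrow> even (weight ?W u v))" for u v
      proof
        assume "{u, v} \<in> wedges ?W"
        note uv = wedges[OF this]
        have "even (weight ?W u v) \<longleftrightarrow> (even (hamming u 0) \<longleftrightarrow> even (hamming v 0))"
          using w(1)[OF uv] ev[OF uv(1,2)] par by (simp add: W)
        then show "(u \<in> X \<and> v \<in> Y \<longrightarrow> odd (weight ?W u v)) \<and>
            (u \<in> X \<and> v \<in> X \<or> u \<in> Y \<and> v \<in> Y \<longrightarrow> even (weight ?W u v))"
          unfolding X_def Y_def by blast
      qed
    qed
    then show "\<exists>X Y. X \<union> Y = wverts ?W \<and> X \<inter> Y = {} \<and> (\<forall>u v. {u, v} \<in> wedges ?W \<longrightarrow>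
        (u \<in> X \<and> v \<in> Y \<longrightarrow> odd (weight ?W u v)) \<and>
        (u \<in> X \<and> v \<in> X \<or> u \<in> Y \<and> v \<in> Y \<longrightarrow> even (weight ?W u v)))"
      by (intro exI)
  next
    fix u v assume "{u, v} \<in> wedges ?W"
    note uv = wedges[OF this]
    show "weight ?W u v = weight ?W v u"
      using w(1)[OF uv] w(1)[OF uv(2,1)] uv(3) diff_set_commute[of u v] by (simp add: W)
    show "weight ?W u v \<noteq> 0" "\<bar>weight ?W u v\<bar> \<le> int k"
      using w[OF uv] by (auto simp: signed_residue_def W)
  qed
qed

theorem theorem3p4:
  fixes k :: nat
  assumes "k \<ge> 2"
  shows "all_k_good k (complete_signed_distance_graph (SPC (2 * k - 1)))"
proof -
  define d where "d = 2 * k - 1"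
  have k: "k \<ge> 2" "Suc d = 2 * k" using assms by (simp_all add: d_def)
  let ?W = "complete_signed_distance_graph (SPC d)"
  have W: "wverts ?W = bit_vectors d" "weight ?W = alg_dist (SPC d)"
    by (simp_all add: complete_signed_distance_graph_def)
  have wedges: "{u, v} \<in> wedges ?W \<longleftrightarrow> u \<in> bit_vectors d \<and> v \<in> bit_vectors d \<and> u \<noteq> v" for u v
    by (auto simp: complete_signed_distance_graph_def doubleton_eq_iff)
  have ex: "\<exists>z\<in>wverts ?W. {u, z} \<in> wedges ?W \<and> {v, z} \<in> wedges ?W \<and>
      (same_weight k (weight ?W u z) q \<and> same_weight k (weight ?W v z) r \<or>
       same_weight k (weight ?W u z) (- q) \<and> same_weight k (weight ?W v z) (- r))"
    if uv: "{u, v} \<in> wedges ?W" and good: "k_good k (weight ?W u v) q r" for u v q r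
  proof -
    define a where "a = hamming u v"
    define b where "b = residue k q"
    define c where "c = residue k r"
    have V: "u \<in> bit_vectors d" "v \<in> bit_vectors d" "u \<noteq> v" using uv wedges by auto
    have a: "0 < a" "a < 2 * k"
      using hamming_eq_0_iff[OF V(1,2)] hamming_le[OF V(1,2)] V(3) k by (auto simp: a_def)
    have res: "residue k (weight ?W u v) = a"
      using residue_signed_residue[OF a] by (simp add: W alg_dist_SPC[OF k V] a_def)
    have qr: "q \<noteq> 0" "\<bar>q\<bar> \<le> int k" "r \<noteq> 0" "\<bar>r\<bar> \<le> int k"
      using good by (auto simp: k_good_def)
    have bc: "0 < b" "b < 2 * k" "0 < c" "c < 2 * k"
      using residue_eq[OF qr(1,2)] residue_eq[OF qr(3,4)] qr by (auto simp: b_def c_def split: if_splits)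
    note tri = k_good_residues[OF assms good, unfolded res, folded b_def c_def]
    have found: "\<exists>z\<in>bit_vectors d. u \<noteq> z \<and> v \<noteq> z \<and>
        weight ?W u z = signed_residue k b' \<and> weight ?W v z = signed_residue k c'"
      if pos: "0 < b'" "0 < c'" and tri: "a \<le> b' + c'" "b' \<le> a + c'" "c' \<le> a + b'" "a + b' + c' \<le> 2 * d"
        "even (a + b' + c')" for b' c'
    proof -
      obtain z where z: "z \<in> bit_vectors d" "hamming u z = b'" "hamming v z = c'"
        using exists_vertex_with_distances[OF V(1,2), folded a_def, OF tri] by blast
      have "u \<noteq> z" "v \<noteq> z" using z pos by (auto simp: diff_set_def)
      then show ?thesis using z V by (auto simp: W alg_dist_SPC[OF k])
    qed
    show ?thesis
    proof (cases "a + b + c = 4 * k")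
      case False
      \<comment> \<open>By parity the perimeter is at most \<open>4k - 2\<close>.\<close>
      have "a + b + c \<le> 2 * d"
        using tri(4,5) False k(2) by presburger
      then obtain z where "z \<in> bit_vectors d" "u \<noteq> z" "v \<noteq> z"
          "weight ?W u z = signed_residue k b" "weight ?W v z = signed_residue k c"
        using found[OF bc(1,3) tri(1-3) _ tri(5)] by blast
      then show ?thesis
        using same_weight_signed_residue(1)[OF qr(1,2)] same_weight_signed_residue(1)[OF qr(3,4)] V
        unfolding wedges by (auto simp: W(1) b_def c_def)
    next
      case True
      have "\<exists>z\<in>bit_vectors d. u \<noteq> z \<and> v \<noteq> z \<and>
        weight ?W u z = signed_residue k (2 * k - b) \<and> weight ?W v z = signed_residue k (2 * k - c)"
      proof (rule found)
        show "even (a + (2 * k - b) + (2 * k - c))" using tri(5) bc by presburger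
      qed (use True bc a k in linarith)+
      then obtain z where "z \<in> bit_vectors d" "u \<noteq> z" "v \<noteq> z"
          "weight ?W u z = signed_residue k (2 * k - b)"
          "weight ?W v z = signed_residue k (2 * k - c)"
        by blast
      then show ?thesis
        using same_weight_signed_residue(2)[OF qr(1,2)] same_weight_signed_residue(2)[OF qr(3,4)] V
        unfolding wedges by (auto simp: W(1) b_def c_def)
    qed
  qed
  show ?thesis
    unfolding all_k_good_def d_def[symmetric] using admissible_SPC[OF k] ex by blast
qed

end
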